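(* Let $A$ be an arbitrary-dimensional evolution $\mathbb{K}$-algebra which is finitely generated as an algebra, and let $E$ be the directed graph associated to $A$ relative to a natural basis $B$. Then $E^0$ agrees with the hereditary closure of a finite set, i.e. there is a finite subset $S\subset E^0$ with $\overline{S}=E^0$.
   Context: An evolution algebra over a field $\mathbb{K}$ is a (not necessarily associative or finite-dimensional) $\mathbb{K}$-algebra $A$ having a basis $B=\{e_i\}_{i\in\Lambda}$, called a natural basis, with $e_ie_j=0$ whenever $i\neq j$. The associated directed graph $E$ relative to $B$ has vertex set $E^0=B$ and exactly one edge from $e_i$ to $e_j$ if the coefficient of $e_j$ in $e_i^2$ is nonzero, and no edge otherwise. A subset $H\subset E^0$ is hereditary if, for every $u\in H$, every vertex reachable from $u$ by a directed path belongs to $H$. The hereditary closure $\overline{S}$ of $S\subset E^0$ is the smallest hereditary subset of $E^0$ containing $S$. *)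

theory Defs
  imports "HOL.Vector_Spaces" "HOL.Hull" "Graph_Theory.Pair_Digraph"
begin

locale nonassoc_algebra = vector_space scale
  for scale :: "'k::field \<Rightarrow> 'a::ab_group_add \<Rightarrow> 'a" (infixr \<open>*s\<close> 75) +
  fixes mult :: "'a \<Rightarrow> 'a \<Rightarrow> 'a" (infixl \<open>\<star>\<close> 70)
  assumes mult_linear_left: "Vector_Spaces.linear scale scale (\<lambda>x. x \<star> y)"
    and mult_linear_right: "Vector_Spaces.linear scale scale (\<lambda>y. x \<star> y)"
begin

definition subalgebra :: "'a set \<Rightarrow> bool" where
  "subalgebra U \<longleftrightarrow> subspace U \<and> (\<forall>x\<in>U. \<forall>y\<in>U. x \<star> y \<in> U)"

text \<open>No unit is assumed, so subalgebras and generation are understood in the non-unital sense.\<close>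

definition finitely_generated :: bool where
  "finitely_generated \<longleftrightarrow> (\<exists>X. finite X \<and> subalgebra hull X = UNIV)"

definition natural_basis :: "'a set \<Rightarrow> bool" where
  "natural_basis B \<longleftrightarrow> independent B \<and> span B = UNIV \<and>
     (\<forall>u\<in>B. \<forall>v\<in>B. u \<noteq> v \<longrightarrow> u \<star> v = 0)"

definition associated_graph :: "'a set \<Rightarrow> 'a pair_pre_digraph" where
  "associated_graph B =
     \<lparr>pverts = B, parcs = {(u, v). u \<in> B \<and> v \<in> B \<and> representation B (u \<star> u) v \<noteq> 0}\<rparr>"

end

locale evolution_algebra = nonassoc_algebra scale mult
  for scale :: "'k::field \<Rightarrow> 'a::ab_group_add \<Rightarrow> 'a" (infixr \<open>*s\<close> 75)
    and mult :: "'a \<Rightarrow> 'a \<Rightarrow> 'a" (infixl \<open>\<star>\<close> 70) +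
  assumes ex_natural_basis: "\<exists>B. natural_basis B"

definition hereditary :: "('a, 'b) pre_digraph \<Rightarrow> 'a set \<Rightarrow> bool" where
  "hereditary G H \<longleftrightarrow> H \<subseteq> verts G \<and> (\<forall>u\<in>H. \<forall>v. u \<rightarrow>\<^sup>*\<^bsub>G\<^esub> v \<longrightarrow> v \<in> H)"

text \<open>The hull is the intersection of all hereditary sets containing \<open>S\<close>. It is the smallest
  such set when \<open>S \<subseteq> verts G\<close>; for other \<open>S\<close> the intersection is over the
  empty family, and the value is \<open>UNIV\<close>.\<close>

definition hereditary_closure :: "('a, 'b) pre_digraph \<Rightarrow> 'a set \<Rightarrow> 'a set" where
  "hereditary_closure G S = hereditary G hull S"

end

theory Submission
  imports Defs
begin

text \<open>
  Let \<open>S\<close> collect the basis vectors that occur in the expansions of finitely many generators, a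
  finite set.  If \<open>H\<close> is any hereditary set containing \<open>S\<close>, then \<open>span H\<close> is a subalgebra
  (\<open>subalgebra_span_hereditary\<close>): distinct basis vectors multiply to \<open>0\<close>, and the square of a
  basis vector \<open>u \<in> H\<close> is a combination of the out-neighbours of \<open>u\<close>, which lie in \<open>H\<close>.  This
  subalgebra contains the generators, so it is the whole algebra, and a subset of a basis that
  spans everything is the basis itself.  Hence the only hereditary set containing \<open>S\<close> is the full
  vertex set.
\<close>

lemma hereditary_verts: "hereditary G (verts G)"
  by (auto simp: hereditary_def elim: reachable_in_vertsE)

context nonassoc_algebra
begin

lemma mult_span_closed:
  assumes gen: "\<And>u v. u \<in> H \<Longrightarrow> v \<in> H \<Longrightarrow> u \<star> v \<in> span H"
    and x: "x \<in> span H" and y: "y \<in> span H"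
  shows "x \<star> y \<in> span H"
proof -
  have left: "u \<star> y \<in> span H" if "u \<in> H" for u
  proof -
    interpret m: Vector_Spaces.linear scale scale "\<lambda>y. u \<star> y"
      by (rule mult_linear_right)
    show ?thesis
      using y by (induction rule: span_induct_alt)
        (auto simp: m.zero m.add m.scale intro: span_zero span_add span_scale gen that)
  qed
  interpret m: Vector_Spaces.linear scale scale "\<lambda>x. x \<star> y"
    by (rule mult_linear_left)
  show ?thesis
    using x by (induction rule: span_induct_alt)
      (auto simp: m.zero m.add m.scale intro: span_zero span_add span_scale left)
qed

lemma in_span_support:
  assumes "independent B" and "x \<in> span B"
  shows "x \<in> span {b. representation B x b \<noteq> 0}"
proof -
  have "(\<Sum>b | representation B x b \<noteq> 0. representation B x b *s b) = x"
    using assms by (rule sum_nonzero_representation_eq)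
  moreover have "(\<Sum>b | representation B x b \<noteq> 0. representation B x b *s b)
      \<in> span {b. representation B x b \<noteq> 0}"
    by (intro span_sum span_scale span_base) simp
  ultimately show ?thesis by simp
qed

text \<open>
  Hereditariness is exactly what keeps the squares \<open>u \<star> u\<close> inside the span: the support of
  \<open>u \<star> u\<close> is the set of out-neighbours of \<open>u\<close>.
\<close>

lemma subalgebra_span_hereditary:
  assumes B: "natural_basis B"
    and H: "hereditary (with_proj (associated_graph B)) H"
  shows "subalgebra (span H)"
proof -
  have HB: "H \<subseteq> B"
    using H by (simp add: hereditary_def associated_graph_def)
  have "u \<star> v \<in> span H" if u: "u \<in> H" and v: "v \<in> H" for u v
  proof (cases "u = v")
    case False
    then have "u \<star> v = 0"
      using B u v HB by (auto simp: natural_basis_def)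
    then show ?thesis by (simp add: span_zero)
  next
    case True
    have "{w. representation B (u \<star> u) w \<noteq> 0} \<subseteq> H"
    proof
      fix w assume "w \<in> {w. representation B (u \<star> u) w \<noteq> 0}"
      then have w: "representation B (u \<star> u) w \<noteq> 0" by simp
      then have "w \<in> B" by (rule representation_ne_zero)
      with w u HB have "u \<rightarrow>\<^sup>*\<^bsub>with_proj (associated_graph B)\<^esub> w"
        unfolding reachable_def
        by (intro rtrancl_on_into_rtrancl_on[OF rtrancl_on_refl])
          (auto simp: associated_graph_def arcs_ends_def arc_to_ends_def)
      with H u show "w \<in> H" unfolding hereditary_def by blast
    qed
    moreover have "u \<star> u \<in> span {w. representation B (u \<star> u) w \<noteq> 0}"
      using B by (intro in_span_support) (auto simp: natural_basis_def)
    ultimately show ?thesis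
      using True span_mono by blast
  qed
  then show ?thesis
    by (auto simp: subalgebra_def intro: mult_span_closed)
qed

lemma spanning_subset_of_basis:
  assumes "independent B" and "H \<subseteq> B" and "span H = UNIV"
  shows "H = B"
proof (rule ccontr)
  assume "H \<noteq> B"
  then obtain b where b: "b \<in> B" "H \<subseteq> B - {b}" using assms(2) by blast
  then have "b \<in> span (B - {b})" using assms(3) span_mono by blast
  then show False using assms(1) b(1) by (auto simp: dependent_def)
qed

lemma hereditary_superset_of_supports_eq_basis:
  assumes B: "natural_basis B"
    and X: "subalgebra hull X = UNIV"
    and H: "hereditary (with_proj (associated_graph B)) H"
    and supp: "\<And>x. x \<in> X \<Longrightarrow> {b. representation B x b \<noteq> 0} \<subseteq> H"
  shows "H = B"
proof (rule spanning_subset_of_basis)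
  have "X \<subseteq> span H"
  proof
    fix x assume "x \<in> X"
    moreover have "x \<in> span {b. representation B x b \<noteq> 0}"
      using B by (intro in_span_support) (auto simp: natural_basis_def)
    ultimately show "x \<in> span H" using supp span_mono by blast
  qed
  then have "subalgebra hull X \<subseteq> span H"
    using subalgebra_span_hereditary[OF B H] by (rule hull_minimal)
  then show "span H = UNIV" using X by auto
qed (use B H in \<open>auto simp: natural_basis_def hereditary_def associated_graph_def\<close>)

end

theorem lemma4p1:
  fixes scale :: "'k::field \<Rightarrow> 'a::ab_group_add \<Rightarrow> 'a"
    and mult :: "'a \<Rightarrow> 'a \<Rightarrow> 'a"
    and B :: "'a set"
    and E :: "'a pair_pre_digraph"
  assumes "evolution_algebra scale mult"
    and "nonassoc_algebra.finitely_generated scale mult"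
    and "nonassoc_algebra.natural_basis scale mult B"
    and "E = nonassoc_algebra.associated_graph scale mult B"
  shows "\<exists>S. finite S \<and> S \<subseteq> pverts E \<and> hereditary_closure (with_proj E) S = pverts E"
proof -
  interpret evolution_algebra scale mult by fact
  obtain X where X: "finite X" "subalgebra hull X = UNIV"
    using assms(2) unfolding finitely_generated_def by blast
  define S where "S = (\<Union>x\<in>X. {b. representation B x b \<noteq> 0})"
  have verts: "pverts E = B"
    by (simp add: assms(4) associated_graph_def)
  have fin: "finite S"
    using X(1) by (simp add: S_def finite_representation)
  have sub: "S \<subseteq> B"
    using representation_ne_zero by (auto simp: S_def)
  have only: "H = B" if "hereditary (with_proj E) H" "S \<subseteq> H" for H
  proof (rule hereditary_superset_of_supports_eq_basis[OF assms(3) X(2)])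
    show "hereditary (with_proj (associated_graph B)) H"
      using that(1) unfolding assms(4) .
  qed (use that(2) in \<open>auto simp: S_def\<close>)
  have "hereditary (with_proj E) B"
    using hereditary_verts[of "with_proj E"] by (simp add: verts)
  then have "hereditary (with_proj E) hull S = B"
    using sub only by (intro hull_unique) blast+
  then show ?thesis
    using fin sub verts by (auto simp: hereditary_closure_def)
qed

end
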